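(* For any origin-symmetric convex polytope $K\subset\mathbb{R}^n$ with $2m$ facets, there exists a zonotope $Z\subset\mathbb{R}^m$ such that $$\mathrm{Contact}(K,\square_n)=\mathrm{Contact}(\square_m,Z),$$ where $\square_n:=[-1,1]^n$ denotes the standard $n$-dimensional hypercube (and $\square_m:=[-1,1]^m$).
   Context: A zonotope is a Minkowski sum of finitely many segments. For convex sets $K,L$ in the same $\mathbb{R}^d$ with the origin in their relative interiors, with relative boundaries $\partial K,\partial L$: $\partial K$ and $\partial L$ are tangent at a point $x$ if $x\in\partial K\cap\partial L$ and there exists a common supporting hyperplane $H\ni x$ of both $K$ and $L$ such that $K\not\subseteq H$ and $L\not\subseteq H$. Then $$\mathrm{Contact}(K,L)=\{\lambda>0:\ \partial K\text{ and }\lambda\,\partial L\text{ are tangent at some point}\},\qquad \lambda\,\partial L=\{\lambda y:y\in\partial L\}.$$ *)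

theory Defs
  imports "HOL-Analysis.Analysis" "HOL-Library.Set_Algebras"
begin

text \<open>The sum below is the Minkowski sum, i.e. the addition of sets from
  \<^theory>\<open>HOL-Library.Set_Algebras\<close>.\<close>

definition zonotope :: "'a::euclidean_space set \<Rightarrow> bool" where
  "zonotope Z \<longleftrightarrow> (\<exists>(k::nat) a b. Z = (\<Sum>i<k. closed_segment (a i) (b i)))"

definition origin_symmetric :: "'a::real_vector set \<Rightarrow> bool" where
  "origin_symmetric K \<longleftrightarrow> uminus ` K = K"

definition cube :: "(real^'n) set" where
  "cube = cbox (vec (- 1)) (vec 1)"

definition supporting_hyperplane :: "'a::euclidean_space set \<Rightarrow> 'a set \<Rightarrow> bool" where
  "supporting_hyperplane H K \<longleftrightarrow>
     (\<exists>a b. a \<noteq> 0 \<and> H = {y. a \<bullet> y = b} \<and> K \<subseteq> {y. a \<bullet> y \<le> b} \<and> H \<inter> closure K \<noteq> {})"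

definition boundaries_tangent_at :: "'a::euclidean_space set \<Rightarrow> 'a set \<Rightarrow> 'a \<Rightarrow> bool" where
  "boundaries_tangent_at K L x \<longleftrightarrow>
     x \<in> rel_frontier K \<inter> rel_frontier L \<and>
     (\<exists>H. x \<in> H \<and> supporting_hyperplane H K \<and> supporting_hyperplane H L \<and>
          \<not> K \<subseteq> H \<and> \<not> L \<subseteq> H)"

text \<open>For \<open>r > 0\<close>, the relative boundary of \<open>r L\<close> is \<open>r\<close> times the relative boundary of \<open>L\<close>.
  The notion is meant for convex sets with the origin in their relative interiors.\<close>

definition Contact :: "'a::euclidean_space set \<Rightarrow> 'a set \<Rightarrow> real set" where
  "Contact K L = {r. r > 0 \<and> (\<exists>x. boundaries_tangent_at K ((\<lambda>y. r *\<^sub>R y) ` L) x)}"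

end

theory Submission
  imports Defs
begin

text \<open>
  Choose one outward facet normal from each of the \<open>m\<close> pairs of opposite facets of \<open>K\<close> and
  scale it so that the facet lies at height \<open>1\<close>. The normals are the rows of a linear map
  \<open>f\<close> from \<open>\<real>\<^sup>n\<close> to \<open>\<real>\<^sup>m\<close> for which \<open>K\<close> is the preimage of the cube
  (\<open>symmetric_polytope_as_cube_preimage\<close>). The zonotope is the image of the \<open>n\<close>-cube under
  the same map. What remains is an adjunction between preimages and images,
  \<open>Contact (f -` L) M = Contact L (f ` M)\<close>, in lemma \<open>Contact_vimage_eq_Contact_image\<close>.

  The adjunction comes from duality. For bodies around the origin, tangency at \<open>x\<close> means that
  some linear functional is at most \<open>1\<close> on both bodies and equal to \<open>1\<close> at \<open>x\<close>
  (\<open>boundaries_tangent_at_iff\<close>). Such a functional for \<open>L\<close> and \<open>r f(M)\<close> at \<open>f x\<close> pulls back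
  along \<open>f\<close> to one for \<open>f -` L\<close> and \<open>r M\<close> at \<open>x\<close>. Conversely, a functional that is at most \<open>1\<close> on
  \<open>f -` L\<close> factors through \<open>f\<close>, and a Hahn--Banach argument extends the factor to a functional
  that is at most \<open>1\<close> on all of \<open>L\<close> (\<open>functional_bounded_on_vimage_extends\<close>).
\<close>

section \<open>Tangency in terms of linear functionals\<close>

text \<open>A hyperplane that supports \<open>K\<close> without containing it misses the relative interior of
  \<open>K\<close>, hence the origin, so its equation can be normalised to have right-hand side \<open>1\<close>.\<close>

lemma supporting_hyperplane_normalised:
  fixes K :: "'a::euclidean_space set"
  assumes "convex K" "0 \<in> rel_interior K"
    and "supporting_hyperplane H K" "\<not> K \<subseteq> H"
  obtains a where "H = {y. a \<bullet> y = 1}" "K \<subseteq> {y. a \<bullet> y \<le> 1}"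
proof -
  obtain a b where H: "H = {y. a \<bullet> y = b}" and le: "K \<subseteq> {y. a \<bullet> y \<le> b}"
    using assms(3) unfolding supporting_hyperplane_def by auto
  have "0 \<in> K"
    using assms(2) rel_interior_subset by blast
  then have "b \<ge> 0"
    using le by auto
  have "(K \<inter> H) face_of K"
    unfolding H using face_of_Int_supporting_hyperplane_le[OF \<open>convex K\<close>] le by blast
  moreover have "K \<inter> H \<noteq> K"
    using assms(4) by blast
  ultimately have "K \<inter> H \<inter> rel_interior K = {}"
    by (rule face_of_disjoint_rel_interior)
  then have "0 \<notin> H"
    using assms(2) \<open>0 \<in> K\<close> by blast
  with \<open>b \<ge> 0\<close> have "b > 0"
    unfolding H by auto
  show thesis
  proof
    show "H = {y. (a /\<^sub>R b) \<bullet> y = 1}"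
      using \<open>b > 0\<close> by (auto simp: H field_simps)
    show "K \<subseteq> {y. (a /\<^sub>R b) \<bullet> y \<le> 1}"
      using \<open>b > 0\<close> le by (auto simp: field_simps)
  qed
qed

lemma supporting_hyperplane_at_height_1:
  fixes K :: "'a::euclidean_space set"
  assumes "convex K" "0 \<in> K" "K \<subseteq> {y. a \<bullet> y \<le> 1}" "x \<in> K" "a \<bullet> x = 1"
  shows "supporting_hyperplane {y. a \<bullet> y = 1} K" and "\<not> K \<subseteq> {y. a \<bullet> y = 1}"
    and "x \<in> rel_frontier K"
proof -
  have "a \<noteq> 0"
    using assms(5) by auto
  moreover have "{y. a \<bullet> y = 1} \<inter> closure K \<noteq> {}"
    using assms closure_subset by blast
  ultimately show "supporting_hyperplane {y. a \<bullet> y = 1} K"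
    unfolding supporting_hyperplane_def using assms(3) by blast
  show neq: "\<not> K \<subseteq> {y. a \<bullet> y = 1}"
    using assms(2) by auto
  have "(K \<inter> {y. a \<bullet> y = 1}) face_of K"
    using face_of_Int_supporting_hyperplane_le[OF \<open>convex K\<close>] assms(3) by blast
  moreover have "K \<inter> {y. a \<bullet> y = 1} \<noteq> K"
    using neq by blast
  ultimately have "K \<inter> {y. a \<bullet> y = 1} \<inter> rel_interior K = {}"
    by (rule face_of_disjoint_rel_interior)
  then have "x \<notin> rel_interior K"
    using assms(4,5) by blast
  then show "x \<in> rel_frontier K"
    using assms(4) closure_subset unfolding rel_frontier_def by blast
qed

text \<open>The two bodies share a hyperplane a priori, but not a normal vector. Since both
  equations have right-hand side \<open>1\<close>, the common hyperplane determines the functional.\<close>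

lemma hyperplane_at_height_1_unique:
  fixes a a' x :: "'a::real_inner"
  assumes "{y. a \<bullet> y = 1} = {y. a' \<bullet> y = 1}" and "a \<bullet> x = 1"
  shows "a = a'"
proof -
  have x: "a' \<bullet> x = 1"
    using assms by blast
  have "a \<bullet> y = a' \<bullet> y" for y
  proof -
    have "a \<bullet> (y + (1 - a \<bullet> y) *\<^sub>R x) = 1"
      using assms(2) by (simp add: inner_add_right)
    then have "a' \<bullet> (y + (1 - a \<bullet> y) *\<^sub>R x) = 1"
      using assms(1) by blast
    then show ?thesis
      using x by (simp add: inner_add_right)
  qed
  then show ?thesis
    by (metis vector_eq_rdot)
qed

lemma boundaries_tangent_at_iff:
  fixes K L :: "'a::euclidean_space set"
  assumes K: "closed K" "convex K" "0 \<in> rel_interior K"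
    and L: "closed L" "convex L" "0 \<in> rel_interior L"
  shows "boundaries_tangent_at K L x \<longleftrightarrow>
    x \<in> K \<inter> L \<and> (\<exists>a. a \<bullet> x = 1 \<and> K \<subseteq> {y. a \<bullet> y \<le> 1} \<and> L \<subseteq> {y. a \<bullet> y \<le> 1})"
proof
  assume T: "boundaries_tangent_at K L x"
  then obtain H where H: "x \<in> H" "supporting_hyperplane H K" "supporting_hyperplane H L"
      "\<not> K \<subseteq> H" "\<not> L \<subseteq> H"
    unfolding boundaries_tangent_at_def by blast
  obtain a where a: "H = {y. a \<bullet> y = 1}" "K \<subseteq> {y. a \<bullet> y \<le> 1}"
    using supporting_hyperplane_normalised K(2,3) H(2,4) by blast
  obtain a' where a': "H = {y. a' \<bullet> y = 1}" "L \<subseteq> {y. a' \<bullet> y \<le> 1}"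
    using supporting_hyperplane_normalised L(2,3) H(3,5) by blast
  have "a \<bullet> x = 1"
    using a(1) H(1) by blast
  moreover have "a = a'"
    using hyperplane_at_height_1_unique a(1) a'(1) \<open>a \<bullet> x = 1\<close> by metis
  moreover have "x \<in> K \<inter> L"
    using T K(1) L(1) unfolding boundaries_tangent_at_def rel_frontier_def by simp
  ultimately show "x \<in> K \<inter> L \<and>
      (\<exists>a. a \<bullet> x = 1 \<and> K \<subseteq> {y. a \<bullet> y \<le> 1} \<and> L \<subseteq> {y. a \<bullet> y \<le> 1})"
    using a(2) a'(2) by blast
next
  assume R: "x \<in> K \<inter> L \<and>
    (\<exists>a. a \<bullet> x = 1 \<and> K \<subseteq> {y. a \<bullet> y \<le> 1} \<and> L \<subseteq> {y. a \<bullet> y \<le> 1})"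
  then obtain a where a: "a \<bullet> x = 1" "K \<subseteq> {y. a \<bullet> y \<le> 1}" "L \<subseteq> {y. a \<bullet> y \<le> 1}"
    by blast
  have "0 \<in> K" "0 \<in> L"
    using K L rel_interior_subset by blast+
  then show "boundaries_tangent_at K L x"
    unfolding boundaries_tangent_at_def
    using supporting_hyperplane_at_height_1[OF K(2) _ a(2) _ a(1)]
      supporting_hyperplane_at_height_1[OF L(2) _ a(3) _ a(1)] R a(1)
    by (intro conjI IntI exI[of _ "{y. a \<bullet> y = 1}"]) simp_all
qed

lemma Contact_iff:
  fixes K L :: "'a::euclidean_space set"
  assumes K: "closed K" "convex K" "0 \<in> rel_interior K"
    and L: "closed L" "convex L" "0 \<in> rel_interior L"
  shows "r \<in> Contact K L \<longleftrightarrow> r > 0 \<and> (\<exists>x\<in>L. r *\<^sub>R x \<in> K \<and>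
    (\<exists>a. a \<bullet> (r *\<^sub>R x) = 1 \<and> (\<forall>y\<in>K. a \<bullet> y \<le> 1) \<and> (\<forall>y\<in>L. a \<bullet> (r *\<^sub>R y) \<le> 1)))"
proof -
  let ?rL = "(\<lambda>y. r *\<^sub>R y) ` L"
  have lin: "linear (\<lambda>y::'a. r *\<^sub>R y)"
    by (simp add: linear_scale_self)
  have "closed ?rL" "convex ?rL"
    using L closed_scaling convex_scaling by blast+
  moreover have "0 \<in> rel_interior ?rL"
    using rel_interior_convex_linear_image[OF lin L(2)] L(3) by force
  ultimately have tangent: "boundaries_tangent_at K ?rL x \<longleftrightarrow> x \<in> K \<inter> ?rL \<and>
      (\<exists>a. a \<bullet> x = 1 \<and> K \<subseteq> {y. a \<bullet> y \<le> 1} \<and> ?rL \<subseteq> {y. a \<bullet> y \<le> 1})" for x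
    using boundaries_tangent_at_iff[OF K] by blast
  have "\<exists>y\<in>L. x = r *\<^sub>R y" if "boundaries_tangent_at K ?rL x" for x
    using that tangent[of x] by auto
  then have "r \<in> Contact K L \<longleftrightarrow> r > 0 \<and> (\<exists>x\<in>L. boundaries_tangent_at K ?rL (r *\<^sub>R x))"
    unfolding Contact_def mem_Collect_eq by metis
  also have "\<dots> \<longleftrightarrow> r > 0 \<and> (\<exists>x\<in>L. r *\<^sub>R x \<in> K \<and>
      (\<exists>a. a \<bullet> (r *\<^sub>R x) = 1 \<and> (\<forall>y\<in>K. a \<bullet> y \<le> 1) \<and> (\<forall>y\<in>L. a \<bullet> (r *\<^sub>R y) \<le> 1)))"
    using tangent by (intro conj_cong bex_cong refl) (simp add: subset_eq)
  finally show ?thesis .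
qed

section \<open>The adjunction between preimages and images\<close>

text \<open>On the open set \<open>f -` interior L\<close> the bound \<open>a \<le> 1\<close> is strict. So the image of
  the hyperplane \<open>a = 1\<close> misses the interior of \<open>L\<close>, and a hyperplane \<open>c = d\<close> separates the
  two. On a hyperplane a linear functional is bounded below only if it is
  constant there; hence \<open>c \<circ> f\<close> is a multiple \<open>t a\<close> of \<open>a\<close>. The factor \<open>t\<close> is at least the
  value \<open>d > 0\<close>, so division by \<open>t\<close> keeps \<open>L\<close> at height at most \<open>1\<close>.\<close>

lemma functional_bounded_on_vimage_extends:
  fixes f :: "'a::euclidean_space \<Rightarrow> 'b::euclidean_space"
  assumes f: "linear f" and L: "convex L" "0 \<in> interior L"
    and a: "\<And>z. f z \<in> L \<Longrightarrow> a \<bullet> z \<le> 1"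
  obtains c where "\<And>y. y \<in> L \<Longrightarrow> c \<bullet> y \<le> 1" and "\<And>z. c \<bullet> f z = a \<bullet> z"
proof (cases "a = 0")
  case True
  then show thesis
    using that[of 0] by simp
next
  case False
  define H where "H = {z. a \<bullet> z = 1}"
  define x0 where "x0 = a /\<^sub>R (a \<bullet> a)"
  have x0: "a \<bullet> x0 = 1"
    using False by (simp add: x0_def)
  have "f -` interior L \<subseteq> {z. a \<bullet> z \<le> 1}"
    using a interior_subset by blast
  moreover have "open (f -` interior L)"
    using f by (intro open_vimage) (auto intro: linear_continuous_on simp: linear_conv_bounded_linear)
  ultimately have "f -` interior L \<subseteq> {z. a \<bullet> z < 1}"
    using interior_maximal interior_halfspace_le[OF False, of 1] by blast
  then have disj: "interior L \<inter> f ` H = {}"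
    unfolding H_def by auto
  have "convex (f ` H)"
    unfolding H_def using f convex_hyperplane convex_linear_image by blast
  moreover have "f ` H \<noteq> {}"
    using x0 unfolding H_def by blast
  ultimately obtain c d where "c \<noteq> 0" and cL: "\<forall>y\<in>interior L. c \<bullet> y \<le> d"
      and cH: "\<forall>y\<in>f ` H. d \<le> c \<bullet> y"
    using separating_hyperplane_sets[of "interior L" "f ` H"] L disj by (auto simp: convex_interior)
  have "interior L \<subseteq> interior {y. c \<bullet> y \<le> d}"
    using cL by (intro interior_maximal) auto
  then have "d > 0"
    using L(2) \<open>c \<noteq> 0\<close> by auto
  have "closure (interior L) \<subseteq> {y. c \<bullet> y \<le> d}"
    using cL by (intro closure_minimal) (auto simp: closed_halfspace_le)
  then have cL': "c \<bullet> y \<le> d" if "y \<in> L" for y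
    using that convex_closure_interior[OF L(1)] L(2) closure_subset by blast
  have cH': "d \<le> c \<bullet> f z" if "a \<bullet> z = 1" for z
    using cH that unfolding H_def by blast
  have kernel: "c \<bullet> f v = 0" if v: "a \<bullet> v = 0" for v
  proof (rule ccontr)
    assume nz: "c \<bullet> f v \<noteq> 0"
    \<comment> \<open>moving along \<open>v\<close> inside the hyperplane brings \<open>c\<close> down to the value \<open>d - 1\<close>\<close>
    define s where "s = (d - 1 - c \<bullet> f x0) / (c \<bullet> f v)"
    have "d \<le> c \<bullet> f (x0 + s *\<^sub>R v)"
      by (rule cH') (simp add: inner_add_right x0 v)
    also have "\<dots> = d - 1"
      using nz by (simp add: linear_add[OF f] linear_scale[OF f] inner_add_right s_def)
    finally show False by simp
  qed
  define t where "t = c \<bullet> f x0"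
  have "t \<ge> d"
    unfolding t_def using cH' x0 by blast
  have ct: "c \<bullet> f z = t * (a \<bullet> z)" for z
  proof -
    have "c \<bullet> f (z - (a \<bullet> z) *\<^sub>R x0) = 0"
      by (rule kernel) (simp add: inner_diff_right x0)
    then show ?thesis
      by (simp add: linear_diff[OF f] linear_scale[OF f] inner_diff_right t_def)
  qed
  show thesis
  proof (rule that)
    show "(c /\<^sub>R t) \<bullet> y \<le> 1" if "y \<in> L" for y
      using cL'[OF that] \<open>t \<ge> d\<close> \<open>d > 0\<close> by (simp add: field_simps)
    show "(c /\<^sub>R t) \<bullet> f z = a \<bullet> z" for z
      using ct \<open>t \<ge> d\<close> \<open>d > 0\<close> by simp
  qed
qed

text \<open>A contact point \<open>x\<close> on the left corresponds to the contact point \<open>f x\<close> on the right.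
  Functionals travel to the left through the adjoint of \<open>f\<close> and to the right through the
  extension lemma.\<close>

theorem Contact_vimage_eq_Contact_image:
  fixes f :: "'a::euclidean_space \<Rightarrow> 'b::euclidean_space"
  assumes f: "linear f"
    and L: "closed L" "convex L" "0 \<in> interior L"
    and M: "compact M" "convex M" "0 \<in> rel_interior M"
  shows "Contact (f -` L) M = Contact L (f ` M)"
proof -
  have cont: "continuous_on S f" for S
    using f by (simp add: linear_continuous_on linear_conv_bounded_linear)
  have "closed (f -` L)"
    using L(1) cont by (simp add: closed_vimage)
  moreover have "convex (f -` L)"
    using f L(2) by (rule convex_linear_vimage)
  moreover have "0 \<in> rel_interior (f -` L)"
  proof -
    have "open (f -` interior L)"
      using cont by (simp add: open_vimage)
    then have "f -` interior L \<subseteq> interior (f -` L)"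
      by (intro interior_maximal) (use interior_subset in blast)
    then show ?thesis
      using L(3) linear_0[OF f] interior_subset_rel_interior by auto
  qed
  ultimately have left: "r \<in> Contact (f -` L) M \<longleftrightarrow> r > 0 \<and> (\<exists>x\<in>M. r *\<^sub>R x \<in> f -` L \<and>
      (\<exists>a. a \<bullet> (r *\<^sub>R x) = 1 \<and> (\<forall>y\<in>f -` L. a \<bullet> y \<le> 1) \<and> (\<forall>y\<in>M. a \<bullet> (r *\<^sub>R y) \<le> 1)))"
    for r using M by (intro Contact_iff) (auto simp: compact_imp_closed)
  have "closed (f ` M)"
    using M(1) cont compact_continuous_image compact_imp_closed by blast
  moreover have "convex (f ` M)"
    using f M(2) by (rule convex_linear_image)
  moreover have "0 \<in> rel_interior (f ` M)"
    using rel_interior_convex_linear_image[OF f M(2)] M(3) linear_0[OF f] by force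
  moreover have "0 \<in> rel_interior L"
    using L(3) interior_subset_rel_interior by blast
  ultimately have right: "r \<in> Contact L (f ` M) \<longleftrightarrow> r > 0 \<and> (\<exists>x\<in>f ` M. r *\<^sub>R x \<in> L \<and>
      (\<exists>c. c \<bullet> (r *\<^sub>R x) = 1 \<and> (\<forall>y\<in>L. c \<bullet> y \<le> 1) \<and> (\<forall>y\<in>f ` M. c \<bullet> (r *\<^sub>R y) \<le> 1)))"
    for r using L by (intro Contact_iff) auto
  show ?thesis
  proof (intro set_eqI iffI)
    fix r
    assume "r \<in> Contact (f -` L) M"
    then obtain x a where r: "r > 0" and x: "x \<in> M" "f (r *\<^sub>R x) \<in> L"
      and a: "a \<bullet> (r *\<^sub>R x) = 1" "\<And>y. f y \<in> L \<Longrightarrow> a \<bullet> y \<le> 1" "\<forall>y\<in>M. a \<bullet> (r *\<^sub>R y) \<le> 1"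
      unfolding left by auto
    obtain c where c: "\<And>y. y \<in> L \<Longrightarrow> c \<bullet> y \<le> 1" "\<And>z. c \<bullet> f z = a \<bullet> z"
      using functional_bounded_on_vimage_extends[OF f L(2,3) a(2)] by blast
    show "r \<in> Contact L (f ` M)"
      unfolding right
    proof (intro conjI r bexI exI)
      show "c \<bullet> (r *\<^sub>R f x) = 1" "\<forall>y\<in>f ` M. c \<bullet> (r *\<^sub>R y) \<le> 1"
        using a c(2) by (auto simp flip: linear_scale[OF f])
    qed (use x c(1) in \<open>auto simp flip: linear_scale[OF f]\<close>)
  next
    fix r
    assume "r \<in> Contact L (f ` M)"
    then obtain x c where r: "r > 0" and x: "x \<in> M" "f (r *\<^sub>R x) \<in> L"
      and c: "c \<bullet> f (r *\<^sub>R x) = 1" "\<forall>y\<in>L. c \<bullet> y \<le> 1" "\<forall>y\<in>M. c \<bullet> f (r *\<^sub>R y) \<le> 1"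
      unfolding right by (auto simp: linear_scale[OF f])
    have adj: "adjoint f c \<bullet> z = c \<bullet> f z" for z
      using adjoint_works[OF f, of z c] by (simp add: inner_commute)
    show "r \<in> Contact (f -` L) M"
      unfolding left
    proof (intro conjI r bexI[OF _ x(1)] exI[of _ "adjoint f c"])
      show "r *\<^sub>R x \<in> f -` L"
        using x(2) by simp
      show "adjoint f c \<bullet> (r *\<^sub>R x) = 1" "\<forall>y\<in>f -` L. adjoint f c \<bullet> y \<le> 1"
        "\<forall>y\<in>M. adjoint f c \<bullet> (r *\<^sub>R y) \<le> 1"
        unfolding adj using c by blast+
    qed
  qed
qed

section \<open>Linear images of the cube are zonotopes\<close>

lemma zonotope_sum_segments:
  assumes "finite I"
  shows "zonotope (\<Sum>i\<in>I. closed_segment (a i) (b i))"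
proof -
  obtain h :: "nat \<Rightarrow> 'a" where "bij_betw h {..<card I} I"
    using ex_bij_betw_nat_finite[OF assms] unfolding atLeast0LessThan by blast
  then have "(\<Sum>i\<in>I. closed_segment (a i) (b i)) =
      (\<Sum>j<card I. closed_segment (a (h j)) (b (h j)))"
    by (rule sum.reindex_bij_betw[symmetric])
  then show ?thesis
    unfolding zonotope_def
    by (intro exI[of _ "card I"] exI[of _ "\<lambda>j. a (h j)"] exI[of _ "\<lambda>j. b (h j)"])
qed

lemma linear_image_set_plus:
  assumes "linear f"
  shows "f ` (A + B) = f ` A + f ` B"
proof (intro set_eqI iffI)
  fix y
  assume "y \<in> f ` (A + B)"
  then show "y \<in> f ` A + f ` B"
    by (auto elim!: set_plus_elim intro!: set_plus_intro simp: linear_add[OF assms])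
next
  fix y
  assume "y \<in> f ` A + f ` B"
  then obtain a b where "a \<in> A" "b \<in> B" "y = f (a + b)"
    by (auto elim!: set_plus_elim simp: linear_add[OF assms])
  then show "y \<in> f ` (A + B)"
    by blast
qed

lemma linear_image_set_sum:
  assumes "linear f"
  shows "f ` (\<Sum>i\<in>I. S i) = (\<Sum>i\<in>I. f ` S i)"
  by (induction I rule: infinite_finite_induct)
    (simp_all add: linear_image_set_plus[OF assms] linear_0[OF assms] set_zero)

lemma mem_cube_iff: "x \<in> cube \<longleftrightarrow> (\<forall>i. \<bar>x $ i\<bar> \<le> 1)"
  by (simp add: cube_def mem_box_cart abs_le_iff) (metis minus_le_iff)

lemma cube_eq_sum_segments:
  "(cube :: (real^'n) set) = (\<Sum>i\<in>UNIV. closed_segment (- axis i 1) (axis i 1))"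
proof -
  have seg: "y \<in> closed_segment (- axis i 1) (axis i 1) \<longleftrightarrow> (\<exists>t. \<bar>t\<bar> \<le> 1 \<and> y = t *\<^sub>R axis i 1)"
    for i and y :: "real^'n"
  proof
    assume "y \<in> closed_segment (- axis i 1) (axis i 1)"
    then obtain u where "0 \<le> u" "u \<le> 1" "y = (1 - u) *\<^sub>R (- axis i 1) + u *\<^sub>R axis i 1"
      unfolding in_segment by blast
    then show "\<exists>t. \<bar>t\<bar> \<le> 1 \<and> y = t *\<^sub>R axis i 1"
      by (intro exI[of _ "2 * u - 1"]) (auto simp: algebra_simps simp flip: scaleR_add_left)
  next
    assume "\<exists>t. \<bar>t\<bar> \<le> 1 \<and> y = t *\<^sub>R axis i 1"
    then obtain t where "\<bar>t\<bar> \<le> 1" "y = t *\<^sub>R axis i 1"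
      by blast
    then show "y \<in> closed_segment (- axis i 1) (axis i 1)"
      unfolding in_segment
      by (intro exI[of _ "(t + 1) / 2"]) (auto simp: vec_eq_iff axis_def field_simps)
  qed
  show ?thesis
  proof (intro set_eqI iffI)
    fix x :: "real^'n"
    assume x: "x \<in> cube"
    have "x = (\<Sum>i\<in>UNIV. x $ i *\<^sub>R axis i 1)"
      using basis_expansion[of x] by (simp add: scalar_mult_eq_scaleR)
    moreover have "x $ i *\<^sub>R axis i 1 \<in> closed_segment (- axis i 1 :: real^'n) (axis i 1)" for i
      by (rule seg[THEN iffD2]) (use x mem_cube_iff in blast)
    ultimately show "x \<in> (\<Sum>i\<in>UNIV. closed_segment (- axis i 1) (axis i 1))"
      unfolding set_sum_alt[OF finite] by blast
  next
    fix x :: "real^'n"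
    assume "x \<in> (\<Sum>i\<in>UNIV. closed_segment (- axis i 1) (axis i 1))"
    then obtain s where s: "x = sum s UNIV" "\<And>i. s i \<in> closed_segment (- axis i 1) (axis i 1)"
      unfolding set_sum_alt[OF finite] by blast
    then obtain t where "\<And>i. \<bar>t i\<bar> \<le> 1 \<and> s i = t i *\<^sub>R axis i 1"
      unfolding seg by metis
    moreover from this have "x $ j = t j" for j
      unfolding s(1) by (simp add: axis_def if_distrib cong: if_cong)
    ultimately show "x \<in> cube"
      unfolding mem_cube_iff by simp
  qed
qed

lemma zonotope_linear_image_cube:
  fixes f :: "real^'n \<Rightarrow> 'a::euclidean_space"
  assumes "linear f"
  shows "zonotope (f ` cube)"
  unfolding cube_eq_sum_segments linear_image_set_sum[OF assms]
    closed_segment_linear_image[OF assms, symmetric]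
  by (rule zonotope_sum_segments) simp

lemma zero_in_interior_cube: "0 \<in> interior (cube :: (real^'n) set)"
  by (simp add: cube_def interior_cbox mem_box_cart)

section \<open>A symmetric polytope as the preimage of a cube\<close>

text \<open>Applied to \<open>F \<mapsto> - F\<close> on the facets, this selects one facet from each opposite pair. The
  proof removes one two-element orbit at a time.\<close>

lemma fixpoint_free_involution_half:
  assumes "finite A"
    and "\<And>x. x \<in> A \<Longrightarrow> g x \<in> A" "\<And>x. x \<in> A \<Longrightarrow> g (g x) = x" "\<And>x. x \<in> A \<Longrightarrow> g x \<noteq> x"
  shows "\<exists>P\<subseteq>A. A = P \<union> g ` P \<and> card A = 2 * card P"
  using assms
proof (induction A rule: finite_psubset_induct)
  case (psubset A)
  show ?case
  proof (cases "A = {}")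
    case False
    then obtain x where x: "x \<in> A"
      by blast
    define B where "B = A - {x, g x}"
    have "\<exists>P\<subseteq>B. B = P \<union> g ` P \<and> card B = 2 * card P"
    proof (rule psubset.IH)
      show "B \<subset> A"
        using x unfolding B_def by blast
      show "g y \<in> B" if "y \<in> B" for y
        using that psubset.prems x unfolding B_def by (metis Diff_iff insert_iff empty_iff)
    qed (use psubset.prems in \<open>auto simp: B_def\<close>)
    then obtain P where P: "P \<subseteq> B" "B = P \<union> g ` P" "card B = 2 * card P"
      by blast
    have A: "A = insert x (insert (g x) B)"
      using x psubset.prems unfolding B_def by blast
    have fin: "finite B" "finite P"
      using psubset.hyps P(1) finite_subset unfolding B_def by (blast, metis finite_Diff finite_subset)
    have "insert x P \<subseteq> A"
      using P(1) A by blast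
    moreover have "A = insert x P \<union> g ` insert x P"
      using A P(2) by blast
    moreover have "card A = 2 * card (insert x P)"
    proof -
      have "card A = card B + 2"
      proof -
        have "x \<notin> insert (g x) B" "g x \<notin> B"
          using psubset.prems(3)[OF x] unfolding B_def by auto
        then show ?thesis
          using A fin(1) by simp
      qed
      moreover have "x \<notin> P"
        using P(1) unfolding B_def by blast
      ultimately show ?thesis
        using P(3) fin by simp
    qed
    ultimately show ?thesis
      by blast
  qed simp
qed

lemma zero_in_interior_origin_symmetric:
  fixes K :: "'a::euclidean_space set"
  assumes "convex K" "origin_symmetric K" "interior K \<noteq> {}"
  shows "0 \<in> interior K"
proof -
  obtain x where x: "x \<in> interior K"
    using assms(3) by blast
  have "- x \<in> interior K"
    using x assms(2) interior_negations[of K] unfolding origin_symmetric_def by auto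
  then have "(1/2) *\<^sub>R x + (1/2) *\<^sub>R (- x) \<in> interior K"
    using x convex_interior[OF assms(1)] by (intro convexD) auto
  then show ?thesis
    by simp
qed

text \<open>Facets of a polyhedron are exposed. The exposing hyperplane misses the interior point
  \<open>0\<close>, so its right-hand side is positive and can be scaled to \<open>1\<close>.\<close>

lemma facet_at_height_1:
  fixes K :: "'a::euclidean_space set"
  assumes "polyhedron K" "0 \<in> interior K" "F facet_of K"
  obtains a where "K \<subseteq> {x. a \<bullet> x \<le> 1}" "F = K \<inter> {x. a \<bullet> x = 1}"
proof -
  have face: "F face_of K" and "F \<noteq> K" and "F \<noteq> {}"
    using assms(3) facet_of_irrefl by (auto simp: facet_of_def)
  then have "F exposed_face_of K"
    using exposed_face_of_polyhedron[OF assms(1)] by blast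
  then obtain a b where ab: "K \<subseteq> {x. a \<bullet> x \<le> b}" "F = K \<inter> {x. a \<bullet> x = b}"
    unfolding exposed_face_of_def by blast
  have "0 \<in> K" "0 \<in> rel_interior K"
    using assms(2) interior_subset interior_subset_rel_interior by blast+
  moreover have "F \<inter> rel_interior K = {}"
    using face_of_disjoint_rel_interior[OF face \<open>F \<noteq> K\<close>] .
  ultimately have "b \<noteq> 0" "b \<ge> 0"
    using ab by auto
  then have "b > 0"
    by simp
  show thesis
  proof
    show "K \<subseteq> {x. (a /\<^sub>R b) \<bullet> x \<le> 1}"
      using ab(1) \<open>b > 0\<close> by (auto simp: field_simps)
    show "F = K \<inter> {x. (a /\<^sub>R b) \<bullet> x = 1}"
      using ab(2) \<open>b > 0\<close> by (auto simp: field_simps)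
  qed
qed

text \<open>The facets cover the boundary, and the ray from the interior point \<open>0\<close> to \<open>x\<close> has to
  cross the boundary. This is what makes the facet inequalities sufficient for membership
  in \<open>K\<close>.\<close>

lemma facet_between_origin_and_outside_point:
  fixes K :: "'a::euclidean_space set"
  assumes "polytope K" "0 \<in> interior K" "x \<notin> K"
  obtains F t where "F facet_of K" "0 < t" "t < 1" "t *\<^sub>R x \<in> F"
proof -
  have "x \<noteq> 0"
    using assms(2,3) interior_subset by blast
  then obtain d where d: "0 < d" "d *\<^sub>R x \<in> frontier K"
      "\<And>e. \<lbrakk>0 \<le> e; e < d\<rbrakk> \<Longrightarrow> e *\<^sub>R x \<in> interior K"
    using ray_to_frontier[OF polytope_imp_bounded[OF assms(1)] assms(2), of x] by auto
  have "K - rel_interior K = \<Union> {F. F facet_of K}"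
    using rel_boundary_of_polyhedron polytope_imp_polyhedron[OF assms(1)] by blast
  moreover have "rel_interior K = interior K"
    using assms(2) rel_interior_nonempty_interior by blast
  moreover have dK: "d *\<^sub>R x \<in> K" and "d *\<^sub>R x \<notin> interior K"
    using d(2) polytope_imp_closed[OF assms(1)] by (auto simp: frontier_def)
  ultimately obtain F where F: "F facet_of K" "d *\<^sub>R x \<in> F"
    by blast
  have "\<not> 1 < d"
    using d(3)[of 1] assms(3) interior_subset by auto
  moreover have "d \<noteq> 1"
    using dK assms(3) by auto
  ultimately have "d < 1"
    by simp
  with F d(1) show thesis
    using that by blast
qed

lemma uminus_facet_of_origin_symmetric:
  fixes K :: "'a::euclidean_space set"
  assumes "origin_symmetric K" "F facet_of K"
  shows "(uminus ` F) facet_of K"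
proof -
  have lin: "linear (uminus :: 'a \<Rightarrow> 'a)" and inj: "inj (uminus :: 'a \<Rightarrow> 'a)"
    by (auto intro: linear_uminus)
  have K: "uminus ` K = K"
    using assms(1) unfolding origin_symmetric_def .
  have "(uminus ` F) face_of (uminus ` K)"
    using assms(2) face_of_linear_image[OF lin inj] by (simp add: facet_of_def)
  moreover have "aff_dim (uminus ` F) = aff_dim F"
    using aff_dim_injective_linear_image[OF lin inj] .
  ultimately show ?thesis
    using assms(2) unfolding K facet_of_def by simp
qed

text \<open>Half of the facets suffices: if the ray through \<open>x \<notin> K\<close> leaves through a facet
  that was not chosen, then the ray through \<open>- x\<close> leaves through the opposite facet, which was
  chosen, and its coordinate at \<open>x\<close> is below \<open>- 1\<close>.\<close>

theorem symmetric_polytope_as_cube_preimage: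
  fixes K :: "'a::euclidean_space set"
  assumes K: "polytope K" "origin_symmetric K" "0 \<in> interior K"
    and card: "card {F. F facet_of K} = 2 * CARD('m::finite)"
  obtains f :: "'a \<Rightarrow> real^'m" where "linear f" "K = f -` cube"
proof -
  let ?N = "{F. F facet_of K}"
  have poly: "polyhedron K"
    using K(1) polytope_imp_polyhedron by blast
  have "\<exists>a. K \<subseteq> {x. a \<bullet> x \<le> 1} \<and> F = K \<inter> {x. a \<bullet> x = 1}" if "F facet_of K" for F
    using facet_at_height_1[OF poly K(3) that] by metis
  then obtain a where a: "\<And>F. F facet_of K \<Longrightarrow> K \<subseteq> {x. a F \<bullet> x \<le> 1}"
      "\<And>F. F facet_of K \<Longrightarrow> F = K \<inter> {x. a F \<bullet> x = 1}"
    by metis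
  have aF: "a F \<bullet> x = 1" if "F facet_of K" "x \<in> F" for F x
    using a(2)[OF that(1)] that(2) by blast
  have "uminus ` F \<noteq> F" if F: "F facet_of K" for F
  proof
    assume eq: "uminus ` F = F"
    obtain y where "y \<in> F"
      using F unfolding facet_of_def by blast
    moreover from this have "- y \<in> F"
      using eq by blast
    ultimately show False
      using aF[OF F, of y] aF[OF F, of "- y"] by simp
  qed
  moreover have "uminus ` uminus ` F = F" for F :: "'a set"
    by (simp add: image_image)
  ultimately obtain P where P: "P \<subseteq> ?N" "?N = P \<union> (`) uminus ` P" "card ?N = 2 * card P"
    using fixpoint_free_involution_half[of ?N "(`) uminus"] finite_polytope_facets[OF K(1)]
      uminus_facet_of_origin_symmetric[OF K(2)] by auto
  have "finite P"
    using P(1) finite_polytope_facets[OF K(1)] finite_subset by blast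
  then obtain h :: "'m \<Rightarrow> 'a set" where h: "bij_betw h UNIV P"
    using finite_same_card_bij[of "UNIV :: 'm set" P] P(3) card by auto
  define f :: "'a \<Rightarrow> real^'m" where "f x = (\<chi> i. a (h i) \<bullet> x)" for x
  have "linear f"
    by (rule linearI) (simp_all add: f_def vec_eq_iff inner_add_right)
  have range_h: "range h = P"
    using h by (simp add: bij_betw_def)
  have "f x \<in> cube \<longleftrightarrow> (\<forall>i. \<bar>a (h i) \<bullet> x\<bar> \<le> 1)" for x
    by (simp add: mem_cube_iff f_def)
  then have f_cube: "f x \<in> cube \<longleftrightarrow> (\<forall>F\<in>P. \<bar>a F \<bullet> x\<bar> \<le> 1)" for x
    by (simp flip: range_h)
  have "x \<in> K \<longleftrightarrow> f x \<in> cube" for x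
  proof
    assume x: "x \<in> K"
    then have "- x \<in> K"
      using K(2) unfolding origin_symmetric_def by blast
    with x have "a F \<bullet> x \<le> 1 \<and> a F \<bullet> (- x) \<le> 1" if "F \<in> P" for F
      using a(1)[of F] P(1) that by blast
    then have "\<bar>a F \<bullet> x\<bar> \<le> 1" if "F \<in> P" for F
      using that by (simp add: abs_le_iff)
    then show "f x \<in> cube"
      unfolding f_cube by blast
  next
    assume x: "f x \<in> cube"
    show "x \<in> K"
    proof (rule ccontr)
      assume "x \<notin> K"
      then obtain F t where F: "F facet_of K" "t *\<^sub>R x \<in> F" and t: "0 < t" "t < 1"
        using facet_between_origin_and_outside_point K(1,3) by metis
      from F(1) P(2) consider "F \<in> P" | G where "G \<in> P" "F = uminus ` G"
        by blast
      then obtain G where G: "G \<in> P" "\<bar>a G \<bullet> (t *\<^sub>R x)\<bar> = 1"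
      proof cases
        case 1
        then show thesis
          using that[of F] aF[OF F] by simp
      next
        case (2 G)
        then have "- (t *\<^sub>R x) \<in> G" "G facet_of K"
          using F(2) P(1) by auto
        then have "a G \<bullet> (- (t *\<^sub>R x)) = 1"
          using aF by blast
        then show thesis
          using that[OF 2(1)] by (simp add: abs_if)
      qed
      have "\<bar>a G \<bullet> (t *\<^sub>R x)\<bar> = t * \<bar>a G \<bullet> x\<bar>"
        using t by (simp add: abs_mult)
      also have "\<dots> \<le> t * 1"
        using x G(1) t unfolding f_cube by (intro mult_left_mono) auto
      finally show False
        using G(2) t by simp
    qed
  qed
  then have "K = f -` cube"
    by blast
  with \<open>linear f\<close> show thesis
    by (rule that)
qed

section \<open>Contact with the cube\<close>

theorem theorem59:
  fixes K :: "(real^'n) set"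
  assumes "polytope K"
    and "aff_dim K = int CARD('n)"
    and "origin_symmetric K"
    and "card {F. F facet_of K} = 2 * CARD('m::finite)"
  shows "\<exists>Z :: (real^'m) set. zonotope Z \<and> 0 \<in> rel_interior Z \<and>
           Contact K (cube :: (real^'n) set) = Contact (cube :: (real^'m) set) Z"
proof -
  have "convex K"
    using assms(1) polytope_imp_convex by blast
  moreover have "interior K \<noteq> {}"
  proof -
    have "affine hull K = UNIV"
      using assms(2) by (simp flip: aff_dim_eq_full)
    moreover have "K \<noteq> {}"
      using assms(2) by auto
    ultimately show ?thesis
      using rel_interior_eq_empty[OF \<open>convex K\<close>] rel_interior_interior by metis
  qed
  ultimately have "0 \<in> interior K"
    using assms(3) zero_in_interior_origin_symmetric by blast
  then obtain f :: "real^'n \<Rightarrow> real^'m" where f: "linear f" "K = f -` cube"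
    using symmetric_polytope_as_cube_preimage[OF assms(1,3) _ assms(4)] by blast
  have compact: "compact (cube :: (real^'n) set)" and convex: "convex (cube :: (real^'n) set)"
    and closed': "closed (cube :: (real^'m) set)" and convex': "convex (cube :: (real^'m) set)"
    by (simp_all add: cube_def compact_cbox closed_cbox)
  have zero: "0 \<in> rel_interior (cube :: (real^'n) set)"
    using zero_in_interior_cube interior_subset_rel_interior by blast
  have "zonotope (f ` cube)"
    using f(1) by (rule zonotope_linear_image_cube)
  moreover have "0 \<in> rel_interior (f ` cube)"
    using rel_interior_convex_linear_image[OF f(1) convex] zero linear_0[OF f(1)] by force
  moreover have "Contact K cube = Contact cube (f ` cube)"
    unfolding f(2)
    by (rule Contact_vimage_eq_Contact_image[OF f(1) closed' convex' zero_in_interior_cube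
          compact convex zero])
  ultimately show ?thesis
    by blast
qed

end
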